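(* For every field $K$ and every outer commutator word $w$, the equality $\operatorname{wid}(FT(K),w)=1$ holds in the group $FT(K)$ of finitary triangular matrices.
   Context: $\mathbb N$ denotes the set of positive integers. $FT(K)$ is the group of all infinite invertible upper triangular matrices over the field $K$, with rows and columns indexed by the positive integers, that differ from the infinite identity matrix in only finitely many entries. The commutator is $[x,y]=x^{-1}y^{-1}xy$. An outer commutator word is a group word obtained from a finite sequence of distinct variables $x_1,x_2,\dots,x_r$ (each used exactly once) using only group commutators, with an arbitrary arrangement of commutator brackets; for instance $[[x_1,x_2],[x_3,x_4]]$ is an outer commutator word, while $[x_1,x_2][x_3,x_4]$ and $[[x_1,x_2],[x_1,x_3]]$ are not. For a group $G$ and a group word $w$, the verbal subgroup $v(G,w)$ is the subgroup of $G$ generated by all values of $w$ on $G$ (all elements obtained by substituting elements of $G$ for the variables of $w$). The width $\operatorname{wid}(G,w)$ is the smallest number $m$ in $\mathbb N\cup\{+\infty\}$ such that every element of $v(G,w)$ is the product of at most $m$ elements, each of which is a value of $w$ on $G$ or the inverse of such a value. *)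

theory Defs
  imports
    "HOL-Algebra.Generated_Groups"
    "HOL-Library.Extended_Nat"
    "HOL-Library.Groups_Big_Fun"
begin

text \<open>
  Rows and columns are indexed by \<^typ>\<open>nat\<close>; index \<open>i\<close> stands for the positive integer \<open>i + 1\<close>.
  Only the order of the index set matters.
\<close>

type_synonym 'k infmat = "nat \<Rightarrow> nat \<Rightarrow> 'k"

definition infmat_one :: "'k::field infmat" where
  "infmat_one i j = (if i = j then 1 else 0)"

text \<open>
  \<^const>\<open>Sum_any\<close> sums over the support of the summand. For upper triangular factors only the
  indices \<open>i \<le> k \<le> j\<close> contribute, so the support is always finite.
\<close>

definition infmat_mult :: "'k::field infmat \<Rightarrow> 'k infmat \<Rightarrow> 'k infmat" where
  "infmat_mult A B i j = Sum_any (\<lambda>k. A i k * B k j)"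

definition upper_triangular_infmat :: "'k::field infmat \<Rightarrow> bool" where
  "upper_triangular_infmat A \<longleftrightarrow> (\<forall>i j. j < i \<longrightarrow> A i j = 0)"

definition invertible_upper_triangular :: "'k::field infmat \<Rightarrow> bool" where
  "invertible_upper_triangular A \<longleftrightarrow> upper_triangular_infmat A \<and>
     (\<exists>B. upper_triangular_infmat B \<and> infmat_mult A B = infmat_one \<and> infmat_mult B A = infmat_one)"

definition finitary_infmat :: "'k::field infmat \<Rightarrow> bool" where
  "finitary_infmat A \<longleftrightarrow> finite {(i, j). A i j \<noteq> infmat_one i j}"

definition FT :: "'k::field infmat monoid" where
  "FT = \<lparr>carrier = {A. invertible_upper_triangular A \<and> finitary_infmat A},
         mult = infmat_mult, one = infmat_one\<rparr>"

lemma infmat_mult_upper: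
  assumes "upper_triangular_infmat A" "upper_triangular_infmat B"
  shows "infmat_mult A B i j = (\<Sum>k\<in>{i..j}. A i k * B k j)"
  unfolding infmat_mult_def
  by (rule Sum_any.expand_superset;
      use assms in \<open>force simp: upper_triangular_infmat_def intro: leI\<close>)

lemma upper_triangular_infmat_one: "upper_triangular_infmat infmat_one"
  by (simp add: upper_triangular_infmat_def infmat_one_def)

lemma upper_triangular_infmat_mult:
  assumes "upper_triangular_infmat A" "upper_triangular_infmat B"
  shows "upper_triangular_infmat (infmat_mult A B)"
  using infmat_mult_upper[OF assms] by (simp add: upper_triangular_infmat_def)

lemma infmat_mult_one_left: "infmat_mult infmat_one A = A"
proof (intro ext)
  fix i j
  have "infmat_mult infmat_one A i j = (\<Sum>k\<in>{i}. infmat_one i k * A k j)"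
    unfolding infmat_mult_def
    by (rule Sum_any.expand_superset) (auto simp: infmat_one_def split: if_splits)
  then show "infmat_mult infmat_one A i j = A i j" by (simp add: infmat_one_def)
qed

lemma infmat_mult_one_right: "infmat_mult A infmat_one = A"
proof (intro ext)
  fix i j
  have "infmat_mult A infmat_one i j = (\<Sum>k\<in>{j}. A i k * infmat_one k j)"
    unfolding infmat_mult_def
    by (rule Sum_any.expand_superset) (auto simp: infmat_one_def split: if_splits)
  then show "infmat_mult A infmat_one i j = A i j" by (simp add: infmat_one_def)
qed

lemma infmat_mult_upper_atMost:
  assumes "upper_triangular_infmat A" "upper_triangular_infmat B"
  shows "infmat_mult A B i j = (\<Sum>k\<le>j. A i k * B k j)"
  unfolding infmat_mult_def
  by (rule Sum_any.expand_superset;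
      use assms in \<open>force simp: upper_triangular_infmat_def intro: leI\<close>)

lemma infmat_mult_assoc:
  assumes A: "upper_triangular_infmat A" and B: "upper_triangular_infmat B"
    and C: "upper_triangular_infmat C"
  shows "infmat_mult (infmat_mult A B) C = infmat_mult A (infmat_mult B C)"
proof (intro ext)
  fix i j
  have AB: "infmat_mult A B i k = (\<Sum>l\<le>j. A i l * B l k)" if "k \<le> j" for k
    unfolding infmat_mult_upper_atMost[OF A B]
    by (rule sum.mono_neutral_left) (use that B in \<open>auto simp: upper_triangular_infmat_def\<close>)
  have "infmat_mult (infmat_mult A B) C i j = (\<Sum>k\<le>j. \<Sum>l\<le>j. A i l * B l k * C k j)"
    unfolding infmat_mult_upper_atMost[OF upper_triangular_infmat_mult[OF A B] C]
    by (intro sum.cong refl) (simp add: AB sum_distrib_right)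
  also have "\<dots> = (\<Sum>l\<le>j. \<Sum>k\<le>j. A i l * B l k * C k j)"
    by (rule sum.swap)
  also have "\<dots> = infmat_mult A (infmat_mult B C) i j"
    unfolding infmat_mult_upper_atMost[OF A upper_triangular_infmat_mult[OF B C]]
      infmat_mult_upper_atMost[OF B C]
    by (simp add: sum_distrib_left mult.assoc)
  finally show "infmat_mult (infmat_mult A B) C i j = infmat_mult A (infmat_mult B C) i j" .
qed

lemma finitary_infmat_iff:
  "finitary_infmat A \<longleftrightarrow> (\<exists>n. \<forall>i j. n \<le> i \<or> n \<le> j \<longrightarrow> A i j = infmat_one i j)"
proof
  assume "finitary_infmat A"
  then have fin: "finite {(i, j). A i j \<noteq> infmat_one i j}" (is "finite ?S")
    by (simp add: finitary_infmat_def)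
  then have "finite (fst ` ?S \<union> snd ` ?S)" by blast
  then obtain n where n: "\<forall>x \<in> fst ` ?S \<union> snd ` ?S. x < n"
    using finite_nat_set_iff_bounded by blast
  have "A i j = infmat_one i j" if "n \<le> i \<or> n \<le> j" for i j
  proof (rule ccontr)
    assume "A i j \<noteq> infmat_one i j"
    then have "(i, j) \<in> ?S" by simp
    then have "i \<in> fst ` ?S" "j \<in> snd ` ?S" by force+
    with n that show False by (meson UnI1 UnI2 not_le)
  qed
  then show "\<exists>n. \<forall>i j. n \<le> i \<or> n \<le> j \<longrightarrow> A i j = infmat_one i j" by blast
next
  assume "\<exists>n. \<forall>i j. n \<le> i \<or> n \<le> j \<longrightarrow> A i j = infmat_one i j"
  then obtain n where n: "\<And>i j. n \<le> i \<or> n \<le> j \<Longrightarrow> A i j = infmat_one i j" by blast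
  have "{(i, j). A i j \<noteq> infmat_one i j} \<subseteq> {..<n} \<times> {..<n}"
    using n by (fastforce simp: not_le[symmetric])
  then show "finitary_infmat A"
    unfolding finitary_infmat_def by (rule finite_subset) simp
qed

lemma infmat_mult_row:
  assumes "A i = infmat_one i"
  shows "infmat_mult A B i = B i"
proof -
  have "infmat_mult A B i = infmat_mult infmat_one B i"
    unfolding infmat_mult_def assms by simp
  then show ?thesis by (simp add: infmat_mult_one_left)
qed

lemma infmat_mult_column:
  assumes "\<And>k. B k j = infmat_one k j"
  shows "infmat_mult A B i j = A i j"
proof -
  have "infmat_mult A B i j = infmat_mult A infmat_one i j"
    unfolding infmat_mult_def assms by simp
  then show ?thesis by (simp add: infmat_mult_one_right)
qed

lemma finitary_infmat_mult:
  assumes "finitary_infmat A" "finitary_infmat B"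
  shows "finitary_infmat (infmat_mult A B)"
proof -
  obtain n where A: "\<And>i j. n \<le> i \<or> n \<le> j \<Longrightarrow> A i j = infmat_one i j"
    using assms(1) unfolding finitary_infmat_iff by blast
  obtain m where B: "\<And>i j. m \<le> i \<or> m \<le> j \<Longrightarrow> B i j = infmat_one i j"
    using assms(2) unfolding finitary_infmat_iff by blast
  have "infmat_mult A B i j = infmat_one i j" if "max n m \<le> i \<or> max n m \<le> j" for i j
    using that
  proof
    assume "max n m \<le> i"
    then have "A i = infmat_one i" "B i j = infmat_one i j" by (auto intro!: ext A B)
    then show ?thesis by (simp add: infmat_mult_row)
  next
    assume "max n m \<le> j"
    then have "\<And>k. B k j = infmat_one k j" "A i j = infmat_one i j" by (auto intro!: A B)
    then show ?thesis by (simp add: infmat_mult_column)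
  qed
  then show ?thesis unfolding finitary_infmat_iff by blast
qed

lemma finitary_infmat_inverse:
  assumes "finitary_infmat A" and AB: "infmat_mult A B = infmat_one"
    and BA: "infmat_mult B A = infmat_one"
  shows "finitary_infmat B"
proof -
  obtain n where A: "\<And>i j. n \<le> i \<or> n \<le> j \<Longrightarrow> A i j = infmat_one i j"
    using assms(1) unfolding finitary_infmat_iff by blast
  have "B i j = infmat_one i j" if "n \<le> i \<or> n \<le> j" for i j
    using that
  proof
    assume "n \<le> i"
    then have "A i = infmat_one i" by (auto intro!: ext A)
    then show ?thesis using infmat_mult_row[of A i B] AB by simp
  next
    assume "n \<le> j"
    then show ?thesis using infmat_mult_column[of A j B i] A BA by simp
  qed
  then show ?thesis unfolding finitary_infmat_iff by blast
qed

lemma group_FT: "group (FT :: 'k::field infmat monoid)"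
proof (rule groupI)
  fix A B :: "'k infmat"
  assume "A \<in> carrier FT" "B \<in> carrier FT"
  then have A: "upper_triangular_infmat A" "finitary_infmat A"
    and B: "upper_triangular_infmat B" "finitary_infmat B"
    and ex: "invertible_upper_triangular A" "invertible_upper_triangular B"
    by (auto simp: FT_def invertible_upper_triangular_def)
  obtain A' where A': "upper_triangular_infmat A'" "infmat_mult A A' = infmat_one"
      "infmat_mult A' A = infmat_one"
    using ex(1) by (auto simp: invertible_upper_triangular_def)
  obtain B' where B': "upper_triangular_infmat B'" "infmat_mult B B' = infmat_one"
      "infmat_mult B' B = infmat_one"
    using ex(2) by (auto simp: invertible_upper_triangular_def)
  note up = upper_triangular_infmat_mult
  have "infmat_mult (infmat_mult A B) (infmat_mult B' A') = infmat_one"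
    by (simp add: infmat_mult_assoc A B A' B' up
        flip: infmat_mult_assoc[OF B(1) B'(1) A'(1)])
       (simp add: A' B' infmat_mult_one_left)
  moreover have "infmat_mult (infmat_mult B' A') (infmat_mult A B) = infmat_one"
    by (simp add: infmat_mult_assoc A B A' B' up
        flip: infmat_mult_assoc[OF A'(1) A(1) B(1)])
       (simp add: A' B' infmat_mult_one_left)
  ultimately show "A \<otimes>\<^bsub>FT\<^esub> B \<in> carrier FT"
    using A B A' B' up finitary_infmat_mult
    by (auto simp: FT_def invertible_upper_triangular_def)
next
  show "\<one>\<^bsub>FT\<^esub> \<in> carrier (FT :: 'k infmat monoid)"
    using upper_triangular_infmat_one infmat_mult_one_left
    by (auto simp: FT_def invertible_upper_triangular_def finitary_infmat_def)
next
  fix A B C :: "'k infmat"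
  assume "A \<in> carrier FT" "B \<in> carrier FT" "C \<in> carrier FT"
  then show "A \<otimes>\<^bsub>FT\<^esub> B \<otimes>\<^bsub>FT\<^esub> C = A \<otimes>\<^bsub>FT\<^esub> (B \<otimes>\<^bsub>FT\<^esub> C)"
    by (simp add: FT_def invertible_upper_triangular_def infmat_mult_assoc)
next
  fix A :: "'k infmat"
  show "\<one>\<^bsub>FT\<^esub> \<otimes>\<^bsub>FT\<^esub> A = A" by (simp add: FT_def infmat_mult_one_left)
next
  fix A :: "'k infmat"
  assume "A \<in> carrier FT"
  then show "\<exists>B\<in>carrier FT. B \<otimes>\<^bsub>FT\<^esub> A = \<one>\<^bsub>FT\<^esub>"
    unfolding FT_def invertible_upper_triangular_def
    using finitary_infmat_inverse by fastforce
qed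

text \<open>
  Words are terms in the variables \<open>x\<^sub>0, x\<^sub>1, \<dots>\<close> that are not reduced; the value of a word depends
  only on the element of the free group it denotes.
\<close>

datatype gword = Var nat | One | Inv gword | Mult gword gword

definition Comm :: "gword \<Rightarrow> gword \<Rightarrow> gword" where
  "Comm u v = Mult (Mult (Mult (Inv u) (Inv v)) u) v"

primrec word_eval :: "('a, 'b) monoid_scheme \<Rightarrow> (nat \<Rightarrow> 'a) \<Rightarrow> gword \<Rightarrow> 'a" where
  "word_eval G f (Var n) = f n"
| "word_eval G f One = \<one>\<^bsub>G\<^esub>"
| "word_eval G f (Inv u) = inv\<^bsub>G\<^esub> (word_eval G f u)"
| "word_eval G f (Mult u v) = word_eval G f u \<otimes>\<^bsub>G\<^esub> word_eval G f v"

text \<open>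
  \<open>comm_bracketing xs w\<close>: the word \<open>w\<close> arises from the nonempty sequence of variables \<open>xs\<close> by
  some arrangement of commutator brackets.
\<close>

inductive comm_bracketing :: "nat list \<Rightarrow> gword \<Rightarrow> bool" where
  single: "comm_bracketing [n] (Var n)"
| bracket: "comm_bracketing xs u \<Longrightarrow> comm_bracketing ys v \<Longrightarrow> comm_bracketing (xs @ ys) (Comm u v)"

definition outer_commutator_word :: "gword \<Rightarrow> bool" where
  "outer_commutator_word w \<longleftrightarrow> (\<exists>xs. distinct xs \<and> comm_bracketing xs w)"

definition word_values :: "('a, 'b) monoid_scheme \<Rightarrow> gword \<Rightarrow> 'a set" where
  "word_values G w = {word_eval G f w | f. \<forall>n. f n \<in> carrier G}"

definition verbal_subgroup :: "('a, 'b) monoid_scheme \<Rightarrow> gword \<Rightarrow> 'a set" where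
  "verbal_subgroup G w = generate G (word_values G w)"

text \<open>
  The minimum is taken over positive integers and \<open>\<infinity>\<close>, so the width is at least \<open>1\<close> even if the
  verbal subgroup is trivial. In a group \<open>m = \<infinity>\<close> always qualifies.
\<close>

definition wid :: "('a, 'b) monoid_scheme \<Rightarrow> gword \<Rightarrow> enat" where
  "wid G w = (LEAST m. 1 \<le> m \<and>
     (\<forall>g \<in> verbal_subgroup G w. \<exists>gs.
        enat (length gs) \<le> m \<and>
        set gs \<subseteq> word_values G w \<union> (\<lambda>h. inv\<^bsub>G\<^esub> h) ` word_values G w \<and>
        g = foldr (\<otimes>\<^bsub>G\<^esub>) gs \<one>\<^bsub>G\<^esub>))"

end

theory Submission
  imports Defs
begin

text \<open>
  Let \<open>U k\<close> be the subgroup of matrices that agree with the identity below the \<open>k\<close>-th superdiagonal,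
  so that \<open>U 0\<close> is the whole group, and \<open>U 0 = U 1\<close> over the field with two elements. The values of an
  outer commutator word form one of the \<open>U k\<close>, so they are already a subgroup. Apart from the easy
  inclusion \<open>[U l, U k] \<subseteq> U (l + k)\<close> this needs every \<open>c \<in> U (l + k)\<close> to be a single commutator
  \<open>[a, b]\<close> with \<open>a \<in> U l\<close> and \<open>b \<in> U k\<close>, where \<open>k \<ge> 1\<close>. With \<open>\<beta> = b\<^sup>-\<^sup>1\<close> this means \<open>\<beta> a = a (c \<beta>)\<close>.
  If \<open>\<beta> - 1\<close> lives on the \<open>k\<close>-th superdiagonal only, with nonzero entries, the equation determines row
  \<open>i + k\<close> of \<open>a\<close> from row \<open>i\<close>; the solution has a nonzero diagonal as soon as the \<open>k\<close>-th superdiagonal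
  of \<open>c \<beta>\<close> has no zeros either. For \<open>l \<ge> 1\<close> this is automatic, and for \<open>l = 0\<close> it can be arranged if
  the field has a third element.
\<close>

interpretation FT: group "FT :: 'k::field infmat monoid"
  by (rule group_FT)

lemma mult_FT [simp]: "A \<otimes>\<^bsub>FT\<^esub> B = infmat_mult A B"
  and one_FT [simp]: "\<one>\<^bsub>FT\<^esub> = infmat_one"
  by (simp_all add: FT_def)

lemma upper_triangular_FT: "A \<in> carrier FT \<Longrightarrow> upper_triangular_infmat A"
  by (simp add: FT_def invertible_upper_triangular_def)

section \<open>Inverting triangular matrices\<close>

text \<open>Solves \<open>B A = 1\<close> for the entries of \<open>B\<close> along each row, from
  left to right.\<close>

fun left_inverse_entry :: "'k::field infmat \<Rightarrow> nat \<Rightarrow> nat \<Rightarrow> 'k" where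
  "left_inverse_entry A i j =
     (infmat_one i j - (\<Sum>k<j. left_inverse_entry A i k * A k j)) / A j j"

declare left_inverse_entry.simps [simp del]

lemma left_inverse_entry_upper: "upper_triangular_infmat (left_inverse_entry A)"
proof -
  have "left_inverse_entry A i j = 0" if "j < i" for i j
    using that
  proof (induction j rule: less_induct)
    case (less j)
    then have "(\<Sum>k<j. left_inverse_entry A i k * A k j) = 0"
      by (intro sum.neutral) auto
    then show ?case
      using less.prems by (subst left_inverse_entry.simps) (simp add: infmat_one_def)
  qed
  then show ?thesis by (simp add: upper_triangular_infmat_def)
qed

lemma left_inverse_entry_diagonal:
  assumes "A i i \<noteq> 0"
  shows "left_inverse_entry A i i \<noteq> 0"
proof -
  have "(\<Sum>k<i. left_inverse_entry A i k * A k i) = 0"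
    using left_inverse_entry_upper[of A]
    by (intro sum.neutral) (auto simp: upper_triangular_infmat_def)
  then show ?thesis
    using assms by (subst left_inverse_entry.simps) (simp add: infmat_one_def)
qed

lemma left_inverse_entry_mult:
  assumes "upper_triangular_infmat A" "\<And>i. A i i \<noteq> 0"
  shows "infmat_mult (left_inverse_entry A) A = infmat_one"
proof (intro ext)
  fix i j
  have "infmat_mult (left_inverse_entry A) A i j
      = (\<Sum>k<j. left_inverse_entry A i k * A k j) + left_inverse_entry A i j * A j j"
    unfolding infmat_mult_upper_atMost[OF left_inverse_entry_upper assms(1)]
    by (simp flip: lessThan_Suc_atMost)
  then show "infmat_mult (left_inverse_entry A) A i j = infmat_one i j"
    using assms(2)[of j] by (subst (asm) (2) left_inverse_entry.simps) simp
qed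

text \<open>A left inverse \<open>B\<close> has a left inverse \<open>C\<close> of its own, and
  \<open>C = C (B A) = (C B) A = A\<close> makes \<open>B\<close> two-sided.\<close>

lemma invertible_upper_triangularI:
  assumes A: "upper_triangular_infmat A" "\<And>i. A i i \<noteq> 0"
  shows "invertible_upper_triangular A"
proof -
  define B where "B = left_inverse_entry A"
  define C where "C = left_inverse_entry B"
  have B: "upper_triangular_infmat B" "\<And>i. B i i \<noteq> 0"
    and C: "upper_triangular_infmat C"
    using A by (simp_all add: B_def C_def left_inverse_entry_upper left_inverse_entry_diagonal)
  have BA: "infmat_mult B A = infmat_one" and CB: "infmat_mult C B = infmat_one"
    using A B by (simp_all add: left_inverse_entry_mult B_def C_def)
  have "C = A"
    using infmat_mult_assoc[OF C B(1) A(1)]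
    by (simp add: BA CB infmat_mult_one_left infmat_mult_one_right)
  then show ?thesis
    using A B BA CB by (auto simp: invertible_upper_triangular_def)
qed

section \<open>The filtration by superdiagonals\<close>

definition band_cong :: "nat \<Rightarrow> 'k::field infmat \<Rightarrow> 'k infmat \<Rightarrow> bool" where
  "band_cong t A B \<longleftrightarrow> (\<forall>i j. j < i + t \<longrightarrow> A i j = B i j)"

lemma band_cong_sym: "band_cong t A B \<Longrightarrow> band_cong t B A"
  by (simp add: band_cong_def)

lemma band_cong_trans: "band_cong t A B \<Longrightarrow> band_cong t B C \<Longrightarrow> band_cong t A C"
  by (simp add: band_cong_def)

text \<open>Entry \<open>(i, j)\<close> of the product involves only rows \<open>p\<close> of the
  right factor with \<open>i \<le> p\<close>, so \<open>j < i + t\<close> gives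
  \<open>j < p + t\<close>.\<close>

lemma band_cong_mult_left:
  assumes "band_cong t B B'"
    and A: "upper_triangular_infmat A" and B: "upper_triangular_infmat B" "upper_triangular_infmat B'"
  shows "band_cong t (infmat_mult A B) (infmat_mult A B')"
  unfolding band_cong_def infmat_mult_upper[OF A B(1)] infmat_mult_upper[OF A B(2)]
  using assms(1) by (auto simp: band_cong_def intro!: sum.cong)

definition U :: "nat \<Rightarrow> 'k::field infmat set" where
  "U t = {A \<in> carrier FT. band_cong t A infmat_one}"

lemma U_carrier: "A \<in> U t \<Longrightarrow> A \<in> carrier FT"
  by (simp add: U_def)

lemma U_0: "U 0 = carrier FT"
  using upper_triangular_FT
  by (auto simp: U_def band_cong_def upper_triangular_infmat_def infmat_one_def)

lemma U_memI:
  assumes "band_cong t A infmat_one" "finitary_infmat A" "\<And>i. A i i \<noteq> 0"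
  shows "A \<in> U t"
proof -
  have "upper_triangular_infmat A"
    using assms(1) by (auto simp: upper_triangular_infmat_def band_cong_def infmat_one_def)
  then show ?thesis
    using assms by (simp add: U_def FT_def invertible_upper_triangularI)
qed

lemma FT_diagonal_nonzero:
  assumes "A \<in> carrier FT"
  shows "A i i \<noteq> 0"
proof -
  obtain B where A: "upper_triangular_infmat A" and B: "upper_triangular_infmat B"
    and AB: "infmat_mult A B = infmat_one"
    using assms by (auto simp: FT_def invertible_upper_triangular_def)
  have "A i i * B i i = 1"
    using infmat_mult_upper[OF A B, of i i] by (simp add: AB infmat_one_def)
  then show ?thesis by auto
qed

text \<open>Lets a variable take its values in \<open>U 1\<close> over such a field, so that the
  case \<open>l = 0\<close>, where a third element is used, does not arise.\<close>

lemma carrier_FT_two_elements: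
  assumes "\<And>x::'k::field. x = 0 \<or> x = 1"
  shows "carrier (FT :: 'k infmat monoid) = U 1"
proof -
  have "A \<in> U 1" if A: "A \<in> carrier FT" for A :: "'k infmat"
  proof -
    have "A i j = infmat_one i j" if "j < i + 1" for i j
      using that upper_triangular_FT[OF A] FT_diagonal_nonzero[OF A, of i] assms[of "A i i"]
      by (cases "j = i") (auto simp: infmat_one_def upper_triangular_infmat_def)
    then show ?thesis using A by (simp add: U_def band_cong_def)
  qed
  then show ?thesis by (auto simp: U_carrier)
qed

lemma subgroup_U: "subgroup (U t) (FT :: 'k::field infmat monoid)"
proof (rule FT.subgroupI)
  show "U t \<subseteq> carrier (FT :: 'k infmat monoid)" by (auto simp: U_def)
  have "(infmat_one :: 'k infmat) \<in> U t"
    using FT.one_closed by (simp add: U_def band_cong_def)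
  then show "(U t :: 'k infmat set) \<noteq> {}" by blast
next
  fix A :: "'k infmat" assume A: "A \<in> U t"
  let ?B = "inv\<^bsub>FT\<^esub> A"
  have c: "A \<in> carrier FT" "?B \<in> carrier FT" using A by (simp_all add: U_carrier)
  note u = c[THEN upper_triangular_FT] upper_triangular_infmat_one
  have "band_cong t (infmat_mult ?B A) (infmat_mult ?B infmat_one)"
    using A u by (intro band_cong_mult_left) (simp_all add: U_def)
  then show "?B \<in> U t"
    using FT.l_inv[OF c(1)] c(2)
    by (simp add: U_def infmat_mult_one_right band_cong_sym)
next
  fix A B :: "'k infmat" assume A: "A \<in> U t" and B: "B \<in> U t"
  note c = A[THEN U_carrier] B[THEN U_carrier]
  note u = c[THEN upper_triangular_FT] upper_triangular_infmat_one
  have "band_cong t (infmat_mult A B) (infmat_mult A infmat_one)"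
    using B u by (intro band_cong_mult_left) (simp_all add: U_def)
  moreover have "band_cong t A infmat_one" using A by (simp add: U_def)
  ultimately show "A \<otimes>\<^bsub>FT\<^esub> B \<in> U t"
    using FT.m_closed[OF c] by (simp add: U_def infmat_mult_one_right band_cong_trans)
qed

section \<open>Commutators\<close>

definition commutator :: "('a, 'b) monoid_scheme \<Rightarrow> 'a \<Rightarrow> 'a \<Rightarrow> 'a" where
  "commutator G a b = inv\<^bsub>G\<^esub> a \<otimes>\<^bsub>G\<^esub> inv\<^bsub>G\<^esub> b \<otimes>\<^bsub>G\<^esub> a \<otimes>\<^bsub>G\<^esub> b"

context group
begin

lemma commutator_closed: "a \<in> carrier G \<Longrightarrow> b \<in> carrier G \<Longrightarrow> commutator G a b \<in> carrier G"
  by (simp add: commutator_def)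

lemma mult_commutator:
  assumes "a \<in> carrier G" "b \<in> carrier G"
  shows "b \<otimes> a \<otimes> commutator G a b = a \<otimes> b"
  using assms unfolding commutator_def
  by (simp add: m_assoc) (simp flip: m_assoc)

lemma inv_commutator:
  assumes "a \<in> carrier G" "b \<in> carrier G"
  shows "inv (commutator G a b) = commutator G b a"
  using assms by (simp add: commutator_def inv_mult_group m_assoc)

text \<open>Replaces the commutator equation by one without inverses, linear in the unknown matrix
  \<open>a\<close>.\<close>

lemma eq_commutator_invI:
  assumes "a \<in> carrier G" "b \<in> carrier G" "c \<in> carrier G" "b \<otimes> a = a \<otimes> (c \<otimes> b)"
  shows "c = commutator G a (inv b)"
proof -
  have "commutator G a (inv b) = inv a \<otimes> (b \<otimes> a) \<otimes> inv b"
    using assms(1-3) by (simp add: commutator_def m_assoc)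
  also have "\<dots> = c"
    using assms by (simp add: m_assoc inv_solve_left')
  finally show ?thesis by simp
qed

end

section \<open>Commutators and the filtration\<close>

lemma mult_band_entry:
  assumes A: "A \<in> U k" and B: "B \<in> U l" and j: "j < i + (k + l)"
  shows "infmat_mult A B i j = A i j + B i j - infmat_one i j"
proof -
  note u = A[THEN U_carrier, THEN upper_triangular_FT] B[THEN U_carrier, THEN upper_triangular_FT]
  \<comment> \<open>This is \<open>(A - 1) (B - 1) = 0\<close> term by term: for
    \<open>p < i + k\<close> the first factor vanishes, otherwise \<open>j < p + l\<close> and the
    second does.\<close>
  have entry: "A i p * B p j = infmat_one i p * B p j + A i p * infmat_one p j
      - infmat_one i p * infmat_one p j" for p
  proof -
    have "A i p = infmat_one i p \<or> B p j = infmat_one p j"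
      using A B j by (cases "p < i + k") (auto simp: U_def band_cong_def)
    then show ?thesis by auto
  qed
  have "infmat_mult A B i j = (\<Sum>p\<le>j. A i p * B p j)"
    by (rule infmat_mult_upper_atMost[OF u])
  also have "\<dots> = (\<Sum>p\<le>j. infmat_one i p * B p j) + (\<Sum>p\<le>j. A i p * infmat_one p j)
      - (\<Sum>p\<le>j. infmat_one i p * infmat_one p j)"
    by (simp add: entry sum.distrib sum_subtractf)
  also have "\<dots> = A i j + B i j - infmat_one i j"
    by (simp add: infmat_mult_one_left infmat_mult_one_right u upper_triangular_infmat_one
        flip: infmat_mult_upper_atMost)
  finally show ?thesis .
qed

text \<open>Since \<open>a b = b a [a, b]\<close>, multiplying the congruence by the inverse of
  \<open>b a\<close> on the left leaves \<open>[a, b]\<close> and 1.\<close>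

lemma commutator_in_U_if_band_cong:
  assumes a: "a \<in> carrier FT" and b: "b \<in> carrier FT"
    and eq: "band_cong t (infmat_mult a b) (infmat_mult b a)"
  shows "commutator FT a b \<in> U t"
proof -
  let ?c = "commutator FT a b" and ?g = "infmat_mult b a"
  let ?h = "inv\<^bsub>FT\<^esub> ?g"
  have g: "?g \<in> carrier FT" using FT.m_closed[OF b a] by simp
  have c: "?c \<in> carrier FT" using a b by (rule FT.commutator_closed)
  have gc: "infmat_mult ?g ?c = infmat_mult a b" using FT.mult_commutator[OF a b] by simp
  have ab: "infmat_mult a b \<in> carrier FT" using FT.m_closed[OF a b] by simp
  have "infmat_mult ?h (infmat_mult ?g ?c) = ?c"
    using FT.m_assoc[of ?h ?g ?c] FT.l_inv[OF g] g c by (simp add: infmat_mult_one_left)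
  moreover have "band_cong t (infmat_mult ?h (infmat_mult a b)) (infmat_mult ?h ?g)"
    using eq g ab by (intro band_cong_mult_left upper_triangular_FT) simp_all
  ultimately show ?thesis
    using c FT.l_inv[OF g] by (simp add: gc U_def)
qed

text \<open>In this range the entries of both products are those of \<open>a + b - 1\<close>, which
  is symmetric in \<open>a\<close> and \<open>b\<close>.\<close>

lemma commutator_in_U_add:
  assumes "a \<in> U k" "b \<in> U l"
  shows "commutator FT a b \<in> U (k + l)"
proof (rule commutator_in_U_if_band_cong)
  show "band_cong (k + l) (infmat_mult a b) (infmat_mult b a)"
    using mult_band_entry[OF assms] mult_band_entry[OF assms(2,1)]
    by (auto simp: band_cong_def add.commute)
qed (use assms U_carrier in auto)

text \<open>Both products have the same diagonal. This covers \<open>k = l = 0\<close>, where adding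
  indices gives only \<open>U 0\<close>.\<close>

lemma commutator_in_U_1:
  assumes "a \<in> carrier FT" "b \<in> carrier FT"
  shows "commutator FT a b \<in> U 1"
proof (rule commutator_in_U_if_band_cong)
  note u = assms[THEN upper_triangular_FT]
  have "infmat_mult a b i j = infmat_mult b a i j" if "j < i + 1" for i j
    using that by (cases "j = i") (simp_all add: infmat_mult_upper u)
  then show "band_cong 1 (infmat_mult a b) (infmat_mult b a)"
    by (simp add: band_cong_def)
qed (use assms in auto)

section \<open>Solving the intertwining equation row by row\<close>

text \<open>Row \<open>i\<close> of a solution \<open>a\<close> of \<open>X a = a Y\<close>, where the only nonzero entries of \<open>X\<close> are
  \<open>X i (i + k) = x i\<close> for \<open>i + k < M\<close>.\<close>

fun conj_row :: "nat \<Rightarrow> nat \<Rightarrow> (nat \<Rightarrow> 'k::field) \<Rightarrow> 'k infmat \<Rightarrow> nat \<Rightarrow> nat \<Rightarrow> 'k" where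
  "conj_row k M x Y i =
     (if k = 0 \<or> i < k \<or> M \<le> i then infmat_one i
      else (\<lambda>j. (\<Sum>p\<le>j. conj_row k M x Y (i - k) p * Y p j) / x (i - k)))"

declare conj_row.simps [simp del]

text \<open>\<open>Y\<close> will be \<open>c \<beta> - 1\<close>. \<open>Y_outside\<close> makes
  the solution finitary, \<open>Y_between\<close> keeps it in \<open>U l\<close>, and
  \<open>Y_diag\<close> keeps its diagonal nonzero.\<close>

locale conj_rows =
  fixes k l M :: nat and x :: "nat \<Rightarrow> 'k::field" and Y :: "'k infmat"
  assumes k: "0 < k" and x: "\<And>i. x i \<noteq> 0"
    and Y_outside: "\<And>i j. M \<le> j \<Longrightarrow> Y i j = 0"
    and Y_below: "\<And>i j. j < i + k \<Longrightarrow> Y i j = 0"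
    and Y_between: "\<And>i j. i + k \<le> j \<Longrightarrow> j < i + k + l \<Longrightarrow> j < M \<Longrightarrow>
      Y i j = (if j = i + k then x i else 0)"
    and Y_diag: "\<And>i. i + k < M \<Longrightarrow> Y i (i + k) \<noteq> 0"
begin

abbreviation "a \<equiv> conj_row k M x Y"

lemma row_trivial: "i < k \<or> M \<le> i \<Longrightarrow> a i = infmat_one i"
  by (auto simp: conj_row.simps)

lemma row_step: "i + k < M \<Longrightarrow> a (i + k) j = (\<Sum>p\<le>j. a i p * Y p j) / x i"
  using k by (subst conj_row.simps) simp

lemma row_induct [case_names trivial step]:
  assumes "\<And>i. i < k \<or> M \<le> i \<Longrightarrow> P i" "\<And>i. i + k < M \<Longrightarrow> P i \<Longrightarrow> P (i + k)"
  shows "P i"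
proof (induction i rule: less_induct)
  case (less i)
  show ?case
  proof (cases "i < k \<or> M \<le> i")
    case False
    then have "i - k < i" "i - k + k = i" "i - k + k < M" using k by auto
    then show ?thesis using assms(2)[of "i - k"] less.IH[of "i - k"] by simp
  qed (simp add: assms(1))
qed

lemma row_band: "j < i + l \<Longrightarrow> a i j = infmat_one i j"
proof (induction i arbitrary: j rule: row_induct)
  case (step i)
  \<comment> \<open>For \<open>p < i + l\<close> the induction hypothesis gives
    \<open>a i p = 0\<close>; otherwise \<open>j < p + k\<close> and
    \<open>Y p j = 0\<close>.\<close>
  have "a i p * Y p j = 0" if "p \<noteq> i" for p
    using step that Y_below[of j p] by (cases "p < i + l") (auto simp: infmat_one_def)
  then have "(\<Sum>p\<le>j. a i p * Y p j) = (\<Sum>p\<le>j. if p = i then a i i * Y i j else 0)"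
    by (intro sum.cong) auto
  also have "\<dots> = a i i * Y i j"
    using Y_below[of j i] by auto
  also have "\<dots> = x i * infmat_one (i + k) j"
  proof (cases "j < i + k")
    case True
    then show ?thesis using Y_below by (simp add: infmat_one_def)
  next
    case False
    \<comment> \<open>Here \<open>i + k \<le> j < i + k + l\<close> forces \<open>l > 0\<close>, so
      the induction hypothesis reaches the diagonal.\<close>
    then have "a i i = 1" using step by (simp add: infmat_one_def)
    then show ?thesis
      using False step.prems step.hyps Y_between[of i j] Y_outside[of j i]
      by (cases "j < M") (auto simp: infmat_one_def)
  qed
  finally show ?case using x[of i] step.hyps by (simp add: row_step)
qed (simp add: row_trivial)

lemma row_upper: "upper_triangular_infmat a"
  using row_band by (auto simp: upper_triangular_infmat_def infmat_one_def)

text \<open>Each step from row \<open>i\<close> to row \<open>i + k\<close> multiplies the diagonal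
  entry by \<open>Y i (i + k) / x i\<close>.\<close>

lemma row_diagonal: "a i i \<noteq> 0"
proof (induction i rule: row_induct)
  case (step i)
  have "a i p * Y p (i + k) = 0" if "p \<noteq> i" for p
    using that row_upper Y_below[of "i + k" p]
    by (cases "p < i") (auto simp: upper_triangular_infmat_def)
  then have "(\<Sum>p\<le>i + k. a i p * Y p (i + k)) = (\<Sum>p\<le>i + k. if p = i then a i i * Y i (i + k) else 0)"
    by (intro sum.cong) auto
  also have "\<dots> = a i i * Y i (i + k)" by auto
  finally show ?case using step Y_diag x by (simp add: row_step)
qed (simp add: row_trivial infmat_one_def)

lemma row_finitary: "finitary_infmat a"
proof -
  have "a i j = infmat_one i j" if "M \<le> j" for i j
    using that by (induction i rule: row_induct)
      (auto simp: row_trivial row_step Y_outside infmat_one_def)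
  then show ?thesis unfolding finitary_infmat_iff using row_trivial by metis
qed

lemma row_in_U: "a \<in> U l"
  by (intro U_memI row_finitary row_diagonal) (simp add: band_cong_def row_band)

lemma row_intertwines:
  "(\<Sum>p\<le>j. a i p * Y p j) = (if i + k < M then x i * a (i + k) j else 0)"
proof (cases "i + k < M")
  case True
  then show ?thesis using x[of i] by (simp add: row_step)
next
  case False
  \<comment> \<open>For \<open>i \<le> p\<close> either \<open>M \<le> j\<close>, or
    \<open>j < M \<le> i + k \<le> p + k\<close>.\<close>
  have "a i p * Y p j = 0" for p
  proof (cases "p < i")
    case True
    then show ?thesis using row_upper by (simp add: upper_triangular_infmat_def)
  next
    case p: False
    then show ?thesis using False Y_below[of j p] Y_outside[of j p] by force
  qed
  then have "(\<Sum>p\<le>j. a i p * Y p j) = 0" by (intro sum.neutral) auto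
  then show ?thesis using False by simp
qed

end

lemma U_commutator:
  fixes c :: "'k::field infmat"
  assumes c: "c \<in> U (l + k)" and k: "0 < k"
    and K: "l = 0 \<Longrightarrow> \<exists>z::'k. z \<noteq> 0 \<and> z \<noteq> 1"
  shows "\<exists>a\<in>U l. \<exists>b\<in>U k. c = commutator FT a b"
proof -
  have cc: "c \<in> carrier FT" using c by (rule U_carrier)
  have c_band: "c i j = infmat_one i j" if "j < i + (l + k)" for i j
    using c that by (simp add: U_def band_cong_def)
  obtain M where M: "\<And>i j. M \<le> i \<or> M \<le> j \<Longrightarrow> c i j = infmat_one i j"
    using cc unfolding FT_def by (auto simp: finitary_infmat_iff)
  \<comment> \<open>The two conditions on \<open>x i\<close>: it is a divisor in the recursion, and
    \<open>c i (i + k) + x i\<close> will be the entry of \<open>Y\<close> on the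
    \<open>k\<close>-th superdiagonal.\<close>
  have "\<exists>z. z \<noteq> 0 \<and> c i (i + k) + z \<noteq> 0" for i
  proof (cases "c i (i + k) = 0")
    case True
    then show ?thesis by (intro exI[of _ 1]) simp
  next
    case False
    then have "l = 0" using c_band[of "i + k" i] k by (cases l) (auto simp: infmat_one_def)
    then obtain z :: 'k where "z \<noteq> 0" "z \<noteq> 1" using K by blast
    then show ?thesis
      \<comment> \<open>The sum becomes \<open>c i (i + k) * (1 - z)\<close>.\<close>
      using False by (intro exI[of _ "- c i (i + k) * z"]) (auto simp: algebra_simps)
  qed
  then obtain x where x: "\<And>i. x i \<noteq> 0" "\<And>i. c i (i + k) + x i \<noteq> 0" by metis
  \<comment> \<open>Cutting off at \<open>M\<close> makes \<open>\<beta>\<close> finitary.\<close>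
  define X where "X i j = (if j = i + k \<and> j < M then x i else 0)" for i j
  define \<beta> where "\<beta> i j = infmat_one i j + X i j" for i j
  have \<beta>: "\<beta> \<in> U k"
  proof (rule U_memI)
    show "band_cong k \<beta> infmat_one" by (simp add: band_cong_def \<beta>_def X_def)
    have "\<beta> i j = infmat_one i j" if "M \<le> i \<or> M \<le> j" for i j
      using that by (auto simp: \<beta>_def X_def)
    then show "finitary_infmat \<beta>" unfolding finitary_infmat_iff by blast
    show "\<beta> i i \<noteq> 0" for i using k by (simp add: \<beta>_def X_def infmat_one_def)
  qed
  have \<beta>c: "\<beta> \<in> carrier FT" using \<beta> by (rule U_carrier)
  define Z where "Z = infmat_mult c \<beta>"
  define Y where "Y i j = Z i j - infmat_one i j" for i j
  have Zc: "Z \<in> carrier FT" using FT.m_closed[OF cc \<beta>c] by (simp add: Z_def)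
  have Z_low: "Z i j = c i j + X i j" if "j < i + (l + k + k)" for i j
    using mult_band_entry[OF c \<beta>, of j i] that by (simp add: Z_def \<beta>_def)
  interpret conj_rows k l M x Y
  proof
    show "Y i j = 0" if "M \<le> j" for i j
    proof -
      have "\<And>p. \<beta> p j = infmat_one p j" using that by (auto simp: \<beta>_def X_def)
      then have "Z i j = c i j" unfolding Z_def by (rule infmat_mult_column)
      then show ?thesis using that M by (simp add: Y_def)
    qed
    show "Y i j = 0" if "j < i + k" for i j
      using that by (simp add: Y_def Z_low c_band X_def)
    show "Y i j = (if j = i + k then x i else 0)"
      if "i + k \<le> j" "j < i + k + l" "j < M" for i j
      using that by (simp add: Y_def Z_low c_band X_def)
    show "Y i (i + k) \<noteq> 0" if "i + k < M" for i
      using that x(2)[of i] k by (simp add: Y_def Z_low X_def infmat_one_def)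
  qed (use k x in auto)
  have ac: "a \<in> carrier FT" using row_in_U by (rule U_carrier)
  note u = cc[THEN upper_triangular_FT] \<beta>c[THEN upper_triangular_FT] Zc[THEN upper_triangular_FT]
  \<comment> \<open>With \<open>\<beta> = 1 + X\<close> and \<open>Z = 1 + Y\<close> this reduces to
    \<open>X a = a Y\<close>.\<close>
  have "infmat_mult \<beta> a i j = infmat_mult a Z i j" for i j
  proof -
    have "infmat_mult \<beta> a i j = (\<Sum>p\<le>j. infmat_one i p * a p j) + (\<Sum>p\<le>j. X i p * a p j)"
      by (simp add: infmat_mult_upper_atMost[OF u(2) row_upper] \<beta>_def distrib_right sum.distrib)
    also have "(\<Sum>p\<le>j. infmat_one i p * a p j) = a i j"
      by (simp add: infmat_mult_one_left row_upper upper_triangular_infmat_one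
          flip: infmat_mult_upper_atMost)
    also have "(\<Sum>p\<le>j. X i p * a p j)
        = (\<Sum>p\<le>j. if p = i + k then (if i + k < M then x i * a (i + k) j else 0) else 0)"
      by (intro sum.cong) (auto simp: X_def)
    also have "\<dots> = (if i + k < M then x i * a (i + k) j else 0)"
      using row_upper by (auto simp: upper_triangular_infmat_def)
    also have "\<dots> = (\<Sum>p\<le>j. a i p * Y p j)" by (simp add: row_intertwines)
    also have "\<dots> = infmat_mult a Z i j - (\<Sum>p\<le>j. a i p * infmat_one p j)"
      by (simp add: infmat_mult_upper_atMost[OF row_upper u(3)] Y_def right_diff_distrib sum_subtractf)
    also have "(\<Sum>p\<le>j. a i p * infmat_one p j) = a i j"
      by (simp add: infmat_mult_one_right row_upper upper_triangular_infmat_one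
          flip: infmat_mult_upper_atMost)
    finally show ?thesis by simp
  qed
  then have "\<beta> \<otimes>\<^bsub>FT\<^esub> a = a \<otimes>\<^bsub>FT\<^esub> (c \<otimes>\<^bsub>FT\<^esub> \<beta>)" by (auto simp: Z_def)
  then have "c = commutator FT a (inv\<^bsub>FT\<^esub> \<beta>)"
    using ac \<beta>c cc by (intro FT.eq_commutator_invI)
  then show ?thesis
    using row_in_U subgroup.m_inv_closed[OF subgroup_U \<beta>] by blast
qed

text \<open>Inversion exchanges the two arguments of a commutator. This serves the case where the
  second argument ranges over \<open>U 0\<close>.\<close>

lemma U_commutator_swap:
  fixes c :: "'k::field infmat"
  assumes c: "c \<in> U (l + k)" and k: "0 < k"
    and K: "l = 0 \<Longrightarrow> \<exists>z::'k. z \<noteq> 0 \<and> z \<noteq> 1"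
  shows "\<exists>b\<in>U k. \<exists>a\<in>U l. c = commutator FT b a"
proof -
  have "inv\<^bsub>FT\<^esub> c \<in> U (l + k)" using subgroup.m_inv_closed[OF subgroup_U c] .
  then obtain a b where ab: "a \<in> U l" "b \<in> U k" and "inv\<^bsub>FT\<^esub> c = commutator FT a b"
    using U_commutator k K by blast
  then have "c = commutator FT b a"
    using FT.inv_commutator[of a b] FT.inv_inv[of c] c U_carrier by metis
  then show ?thesis using ab by blast
qed

section \<open>Values of outer commutator words\<close>

lemma word_eval_Comm: "word_eval G f (Comm u v) = commutator G (word_eval G f u) (word_eval G f v)"
  by (simp add: Comm_def commutator_def)

lemma word_eval_cong:
  assumes "comm_bracketing xs w" "\<And>n. n \<in> set xs \<Longrightarrow> f n = g n"
  shows "word_eval G f w = word_eval G g w"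
  using assms by (induction rule: comm_bracketing.induct) (auto simp: word_eval_Comm)

text \<open>As \<open>u\<close> and \<open>v\<close> share no variable, an assignment for each can
  be merged into one.\<close>

lemma word_values_Comm:
  assumes u: "comm_bracketing xs u" and v: "comm_bracketing ys v" and disj: "set xs \<inter> set ys = {}"
  shows "word_values G (Comm u v) =
    {commutator G a b | a b. a \<in> word_values G u \<and> b \<in> word_values G v}"
proof (intro equalityI subsetI)
  fix c assume "c \<in> {commutator G a b | a b. a \<in> word_values G u \<and> b \<in> word_values G v}"
  then obtain f g where f: "\<forall>n. f n \<in> carrier G" and g: "\<forall>n. g n \<in> carrier G"
    and c: "c = commutator G (word_eval G f u) (word_eval G g v)"
    by (auto simp: word_values_def)
  define h where "h n = (if n \<in> set xs then f n else g n)" for n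
  have "word_eval G h u = word_eval G f u" "word_eval G h v = word_eval G g v"
    using disj by (auto intro!: word_eval_cong[OF u] word_eval_cong[OF v] simp: h_def)
  then have "c = word_eval G h (Comm u v)" by (simp add: c word_eval_Comm)
  moreover have "\<forall>n. h n \<in> carrier G" using f g by (simp add: h_def)
  ultimately show "c \<in> word_values G (Comm u v)" unfolding word_values_def by blast
qed (auto simp: word_values_def word_eval_Comm)

text \<open>The second conjunct is carried through the induction because writing elements as
  commutators with an argument in \<open>U 0\<close> takes a third field element.\<close>

lemma word_values_FT:
  assumes "comm_bracketing xs w" "distinct xs"
  shows "\<exists>k. word_values (FT :: 'k::field infmat monoid) w = U k \<and>
    (k = 0 \<longrightarrow> (\<exists>z::'k. z \<noteq> 0 \<and> z \<noteq> 1))"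
  using assms
proof (induction rule: comm_bracketing.induct)
  case (single n)
  have "word_values (FT :: 'k infmat monoid) (Var n) = carrier FT"
  proof (intro equalityI subsetI)
    fix g :: "'k infmat" assume "g \<in> carrier FT"
    then show "g \<in> word_values FT (Var n)"
      unfolding word_values_def by (auto intro!: exI[of _ "\<lambda>_. g"])
  qed (auto simp: word_values_def)
  then show ?case
    using carrier_FT_two_elements[where ?'k = 'k] U_0[where ?'a = 'k] by (metis zero_neq_one)
next
  case (bracket xs u ys v)
  then obtain k l where u: "word_values (FT :: 'k infmat monoid) u = U k"
      and v: "word_values (FT :: 'k infmat monoid) v = U l"
      and K: "k = 0 \<Longrightarrow> \<exists>z::'k. z \<noteq> 0 \<and> z \<noteq> 1" "l = 0 \<Longrightarrow> \<exists>z::'k. z \<noteq> 0 \<and> z \<noteq> 1"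
    by auto
  have "set xs \<inter> set ys = {}" using bracket.prems by simp
  note vals = word_values_Comm[OF bracket.hyps this, where G = "FT :: 'k infmat monoid", unfolded u v]
  \<comment> \<open>Indices add up, except that the commutators of \<open>U 0\<close> with itself
    fill \<open>U 1\<close>.\<close>
  define t where "t = (if k = 0 \<and> l = 0 then 1 else k + l)"
  have "commutator FT a b \<in> U t" if "a \<in> U k" "b \<in> U l" for a b :: "'k infmat"
    using commutator_in_U_add[OF that] commutator_in_U_1[of a b] that[THEN U_carrier]
    by (simp add: t_def)
  moreover have "\<exists>a\<in>U k. \<exists>b\<in>U l. c = commutator FT a b" if c: "c \<in> U t" for c :: "'k infmat"
  proof -
    consider "k = 0" "l = 0" | "0 < l" | "0 < k" by auto
    then show ?thesis
    proof cases
      case 1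
      \<comment> \<open>The second argument is sought in the smaller \<open>U 1\<close>, as its
        index must be positive.\<close>
      then obtain a b :: "'k infmat" where "a \<in> U 0" "b \<in> U 1" "c = commutator FT a b"
        using U_commutator[of c 0 1] c K by (auto simp: t_def)
      then show ?thesis using 1 U_carrier[of b] by (metis U_0)
    next
      case 2
      then show ?thesis using U_commutator[of c k l] c K by (simp add: t_def)
    next
      case 3
      then show ?thesis using U_commutator_swap[of c l k] c K by (simp add: t_def add.commute)
    qed
  qed
  ultimately have "word_values (FT :: 'k infmat monoid) (Comm u v) = U t"
    unfolding vals by blast
  moreover have "t \<noteq> 0" by (simp add: t_def)
  ultimately show ?case by blast
qed

theorem theorem4:
  assumes "outer_commutator_word w"
  shows "wid (FT :: 'k::field infmat monoid) w = 1"
proof -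
  obtain k where vals: "word_values (FT :: 'k infmat monoid) w = U k"
    using assms word_values_FT unfolding outer_commutator_word_def by blast
  \<comment> \<open>The values already form a subgroup, so generating adds nothing.\<close>
  have gen: "verbal_subgroup (FT :: 'k infmat monoid) w \<subseteq> word_values FT w"
    unfolding verbal_subgroup_def vals
    by (rule FT.generate_subgroup_incl[OF subset_refl subgroup_U])
  have "\<exists>gs. enat (length gs) \<le> 1 \<and>
      set gs \<subseteq> word_values FT w \<union> (\<lambda>h. inv\<^bsub>FT\<^esub> h) ` word_values FT w \<and>
      g = foldr (\<otimes>\<^bsub>FT\<^esub>) gs \<one>\<^bsub>FT\<^esub>"
    if "g \<in> verbal_subgroup FT w" for g :: "'k infmat"
    using gen that by (intro exI[of _ "[g]"]) (auto simp: infmat_mult_one_right one_enat_def)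
  then show ?thesis
    unfolding wid_def by (intro Least_equality) auto
qed

end
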